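(* Let $r$ be a prime number, $m$ a positive integer, $N>1$ an integer with $N\mid (r^m-1)$. Let $q$ be a power of a prime $p$ with $\gcd(p,r)=1$ and $N\mid (q-1)$. Let $\varphi:\mathbb{F}_{r^m}^*\to\mathbb{F}_q^*$ be the homomorphism of order $N$ defined in the context, and for $v\in\mathbb{F}_q$ let $C_{(\varphi,v)}$ be the linear code over $\mathbb{F}_q$ with generator matrix $[I_{r^m},P]$, where $P$ is the matrix defined in the context with diagonal value $v$. If $q>2(N+1)$, then there exists $v\in\mathbb{F}_q$ such that $C_{(\varphi,v)}$ is a $[2r^m,r^m]$ LCD code over $\mathbb{F}_q$.
   Context: Fix a primitive element $\alpha$ of $\mathbb{F}_{r^m}$ and a primitive element $\beta$ of $\mathbb{F}_q$, and put $u=\beta^{(q-1)/N}$. Define $\varphi:\mathbb{F}_{r^m}^*\to\mathbb{F}_q^*$ by $\varphi(\alpha^k)=u^k$ for $0\le k\le r^m-2$; this is a group homomorphism of order $N$. Enumerate $\mathbb{F}_{r^m}=\{x_i:1\le i\le r^m\}$. For $v\in\mathbb{F}_q$, $P=(p_{ij})$ is the $r^m\times r^m$ matrix over $\mathbb{F}_q$ with $p_{ij}=\varphi(x_j-x_i)$ for $i\ne j$ and $p_{ii}=v$. An $[n,k]$ linear code over $\mathbb{F}_q$ is a $k$-dimensional subspace of $\mathbb{F}_q^n$; $C^\perp$ is its dual for the inner product $\langle u,w\rangle=\sum_i u_iw_i$. $C$ is LCD (linear complementary dual) if $C\cap C^\perp=\{0\}$. *)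

theory Defs
  imports
    "HOL-Library.Cardinality"
    "HOL-Computational_Algebra.Primes"
    "Jordan_Normal_Form.VS_Connect"
begin

definition primitive_element :: "'a::finite_field \<Rightarrow> bool" where
  "primitive_element a \<longleftrightarrow> a \<noteq> 0 \<and> (\<forall>y. y \<noteq> 0 \<longrightarrow> (\<exists>k::nat. y = a ^ k))"

text \<open>
  \<open>phi \<alpha> \<beta> N\<close> is the map \<open>\<alpha> ^ k \<mapsto> (\<beta> ^ ((q - 1) / N)) ^ k\<close> for \<open>0 \<le> k \<le> r ^ m - 2\<close>, where
  \<open>r ^ m\<close> and \<open>q\<close> are the cardinalities of the two fields. For a primitive element \<open>\<alpha>\<close> the
  exponent \<open>k\<close> exists and is unique at every nonzero argument; the value at \<open>0\<close> is unspecified.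
\<close>
definition phi :: "'a::finite_field \<Rightarrow> 'b::finite_field \<Rightarrow> nat \<Rightarrow> 'a \<Rightarrow> 'b" where
  "phi \<alpha> \<beta> N y =
     (\<beta> ^ ((CARD('b) - 1) div N)) ^ (THE k. k \<le> CARD('a) - 2 \<and> \<alpha> ^ k = y)"

lemma primitive_element_inj_on:
  fixes \<alpha> :: "'a::finite_field"
  assumes "primitive_element \<alpha>"
  shows "inj_on (\<lambda>k. \<alpha> ^ k) {..CARD('a) - 2}"
proof -
  have card2: "CARD('a) \<ge> 2"
    using card_mono[of UNIV "{0, 1::'a}"] by simp
  have nz: "\<alpha> \<noteq> 0" and gen: "\<And>y. y \<noteq> 0 \<Longrightarrow> \<exists>k::nat. y = \<alpha> ^ k"
    using assms by (auto simp: primitive_element_def)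
  have "\<alpha> * \<alpha> ^ (CARD('a) - 1) = \<alpha> * 1"
    using finite_field_power_card_eq_same[of \<alpha>] card2
    by (metis mult.right_neutral power_eq_if not_numeral_le_zero)
  hence one: "\<alpha> ^ (CARD('a) - 1) = 1"
    using nz by simp
  have "(\<lambda>k. \<alpha> ^ k) ` {..CARD('a) - 2} = UNIV - {0}"
  proof (intro equalityI subsetI)
    fix y :: 'a assume "y \<in> UNIV - {0}"
    then obtain k :: nat where k: "y = \<alpha> ^ k" using gen by auto
    let ?c = "CARD('a) - 1"
    have "\<alpha> ^ k = \<alpha> ^ (?c * (k div ?c) + k mod ?c)" by simp
    also have "\<dots> = \<alpha> ^ (k mod ?c)"
      by (simp only: power_add power_mult one power_one mult_1)
    finally have "y = \<alpha> ^ (k mod ?c)" using k by simp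
    moreover have "k mod ?c < ?c" using card2 by simp
    hence "k mod ?c \<in> {..CARD('a) - 2}" by simp
    ultimately show "y \<in> (\<lambda>k. \<alpha> ^ k) ` {..CARD('a) - 2}" by blast
  qed (use nz in auto)
  moreover have "card (UNIV - {0::'a}) = card {..CARD('a) - 2}"
    using card2 by (simp add: card_Diff_singleton)
  ultimately show ?thesis
    by (intro eq_card_imp_inj_on) auto
qed

lemma phi_power:
  fixes \<alpha> :: "'a::finite_field" and \<beta> :: "'b::finite_field"
  assumes "primitive_element \<alpha>" and "k \<le> CARD('a) - 2"
  shows "phi \<alpha> \<beta> N (\<alpha> ^ k) = (\<beta> ^ ((CARD('b) - 1) div N)) ^ k"
proof -
  have "(THE j. j \<le> CARD('a) - 2 \<and> \<alpha> ^ j = \<alpha> ^ k) = k"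
    using assms primitive_element_inj_on[OF assms(1)]
    by (intro the_equality) (auto simp: inj_on_def)
  thus ?thesis by (simp add: phi_def)
qed

text \<open>
  The enumeration \<open>x\<close> and the matrix entries are indexed by \<open>0, \<dots>, CARD('a) - 1\<close> rather than
  \<open>1, \<dots>, CARD('a)\<close>.
\<close>
definition phi_matrix ::
  "'a::finite_field \<Rightarrow> 'b::finite_field \<Rightarrow> nat \<Rightarrow> (nat \<Rightarrow> 'a) \<Rightarrow> 'b \<Rightarrow> 'b mat" where
  "phi_matrix \<alpha> \<beta> N x v =
     mat CARD('a) CARD('a) (\<lambda>(i, j). if i = j then v else phi \<alpha> \<beta> N (x j - x i))"

text \<open>The block matrix \<open>[A, B]\<close>, the column analogue of \<^const>\<open>append_rows\<close>.\<close>
definition append_cols :: "'b::zero mat \<Rightarrow> 'b mat \<Rightarrow> 'b mat" where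
  "append_cols A B = four_block_mat A B (0\<^sub>m 0 (dim_col A)) (0\<^sub>m 0 (dim_col B))"

definition code_of_generator :: "'b::field mat \<Rightarrow> 'b vec set" where
  "code_of_generator G = vec_space.row_space (dim_col G) G"

definition phi_code ::
  "'a::finite_field \<Rightarrow> 'b::finite_field \<Rightarrow> nat \<Rightarrow> (nat \<Rightarrow> 'a) \<Rightarrow> 'b \<Rightarrow> 'b vec set" where
  "phi_code \<alpha> \<beta> N x v = code_of_generator (append_cols (1\<^sub>m CARD('a)) (phi_matrix \<alpha> \<beta> N x v))"

definition linear_code :: "nat \<Rightarrow> nat \<Rightarrow> 'b::field vec set \<Rightarrow> bool" where
  "linear_code n k C \<longleftrightarrow>
     VectorSpace.subspace class_ring C (module_vec TYPE('b) n) \<and>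
     vectorspace.dim class_ring (module_vec TYPE('b) n\<lparr>carrier := C\<rparr>) = k"

definition dual_code :: "nat \<Rightarrow> 'b::field vec set \<Rightarrow> 'b vec set" where
  "dual_code n C = {w \<in> carrier_vec n. \<forall>c\<in>C. c \<bullet> w = 0}"

definition lcd :: "nat \<Rightarrow> 'b::field vec set \<Rightarrow> bool" where
  "lcd n C \<longleftrightarrow> C \<inter> dual_code n C = {0\<^sub>v n}"

end

theory Submission
  imports Defs "Jordan_Normal_Form.DL_Rank"
begin

text \<open>
  With generator matrix \<open>G = [I, P]\<close> the code is LCD of full dimension as soon as
  \<open>G G\<^sup>T = I + P P\<^sup>T\<close> has trivial kernel. Identifying vectors with functions on the field,
  \<open>P - v I\<close> and its transpose become \<open>\<epsilon> S\<close> and \<open>S\<close>, where \<open>S\<close> is convolution with the character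
  \<open>\<chi>\<close> extended by 0 and \<open>\<epsilon> = \<chi>(-1) = \<plusminus>1\<close>. Jacobi sums give \<open>S\<^bsup>N+1\<^esup> = b S\<close> for a scalar \<open>b\<close>. If \<open>f \<noteq> 0\<close>
  is in the kernel, then \<open>(1 + v\<^sup>2) f + v (1 + \<epsilon>) S f + \<epsilon> S\<^sup>2 f = 0\<close>, and eliminating \<open>S\<close> from the two
  relations shows that \<open>v\<close> is a root of a monic polynomial of degree \<open>2 (N + 1)\<close> that depends only on
  \<open>N\<close>, \<open>b\<close> and \<open>\<epsilon>\<close>. A field with more than \<open>2 (N + 1)\<close> elements contains a nonroot.
\<close>

section \<open>Codes given by a generator matrix\<close>

text \<open>The kernel hypothesis says that the rows of \<open>G\<close> are linearly independent,
  so they form a basis of the code.\<close>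

lemma linear_code_code_of_generator:
  fixes G :: "'b::field mat"
  assumes G: "G \<in> carrier_mat k n"
    and ker: "\<And>y. y \<in> carrier_vec k \<Longrightarrow> G\<^sup>T *\<^sub>v y = 0\<^sub>v n \<Longrightarrow> y = 0\<^sub>v k"
  shows "linear_code n k (code_of_generator G)"
proof -
  interpret vec_space "TYPE('b)" n .
  have GT: "G\<^sup>T \<in> carrier_mat n k"
    using G by simp
  have C: "code_of_generator G = span (set (cols G\<^sup>T))"
    using G by (simp add: code_of_generator_def row_space_def)
  have cols: "set (cols G\<^sup>T) \<subseteq> carrier_vec n"
    using G cols_dim[of "G\<^sup>T"] by simp
  \<comment> \<open>Independence concerns the set of columns and does not notice repetitions. Two
    equal columns would put a difference of unit vectors into the kernel.\<close>
  have dist: "distinct (cols G\<^sup>T)"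
  proof (rule ccontr)
    assume "\<not> distinct (cols G\<^sup>T)"
    then obtain i j where ij: "i < k" "j < k" "i \<noteq> j" "col G\<^sup>T i = col G\<^sup>T j"
      using G by (auto simp: distinct_conv_nth)
    define y where "y = unit_vec k i - (unit_vec k j :: 'b vec)"
    have y: "y \<in> carrier_vec k"
      by (simp add: y_def)
    have "G\<^sup>T *\<^sub>v y = G\<^sup>T *\<^sub>v unit_vec k i - G\<^sup>T *\<^sub>v unit_vec k j"
      unfolding y_def by (rule mult_minus_distrib_mat_vec[OF GT]) auto
    also have "\<dots> = col G\<^sup>T i - col G\<^sup>T j"
      using ij(1,2) G by (intro eq_vecI) auto
    also have "\<dots> = 0\<^sub>v n"
      unfolding ij(4) using ij G by (intro eq_vecI) auto
    finally have "y = 0\<^sub>v k"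
      using ker[OF y] by simp
    moreover have "y $ i = 1"
      using ij by (simp add: y_def)
    ultimately show False
      using ij by simp
  qed
  have indpt: "lin_indpt (set (cols G\<^sup>T))"
    using lin_depE[OF GT _ dist] ker by metis
  have "vectorspace.dim class_ring (vs (code_of_generator G)) = k"
    using lin_indpt_full_rank[OF GT dist indpt] by (simp add: C rank_def)
  moreover have "VectorSpace.subspace class_ring (code_of_generator G) V"
    using span_is_subspace[of "set (cols G\<^sup>T)"] cols by (simp add: C)
  ultimately show ?thesis
    by (simp add: linear_code_def)
qed

text \<open>A codeword \<open>G\<^sup>T *\<^sub>v y\<close> in the dual is orthogonal to every row
  of \<open>G\<close>, so \<open>y\<close> lies in the kernel of
  \<open>G * G\<^sup>T\<close>.\<close>

lemma lcd_code_of_generator: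
  fixes G :: "'b::field mat"
  assumes G: "G \<in> carrier_mat k n"
    and ker: "\<And>y. y \<in> carrier_vec k \<Longrightarrow> (G * G\<^sup>T) *\<^sub>v y = 0\<^sub>v k \<Longrightarrow> y = 0\<^sub>v k"
  shows "lcd n (code_of_generator G)"
proof -
  interpret vec_space "TYPE('b)" n .
  have C: "code_of_generator G = row_space G"
    using G by (simp add: code_of_generator_def)
  have C_eq: "code_of_generator G = {w \<in> carrier_vec n. \<exists>y\<in>carrier_vec k. G\<^sup>T *\<^sub>v y = w}"
    using row_space_eq[OF G] G by (simp add: C)
  have "w = 0\<^sub>v n" if w: "w \<in> code_of_generator G" "w \<in> dual_code n (code_of_generator G)" for w
  proof -
    obtain y where y: "y \<in> carrier_vec k" "w = G\<^sup>T *\<^sub>v y"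
      using w C_eq by auto
    have wc: "w \<in> carrier_vec n"
      using w C_eq by auto
    have "set (rows G) \<subseteq> code_of_generator G"
      unfolding C row_space_def using G by (intro in_own_span) (auto simp: rows_def)
    hence "row G i \<bullet> w = 0" if "i < k" for i
      using that w G by (auto simp: dual_code_def rows_def image_subset_iff)
    hence "G *\<^sub>v w = 0\<^sub>v k"
      using G by (intro eq_vecI) auto
    hence "(G * G\<^sup>T) *\<^sub>v y = 0\<^sub>v k"
      using y G by simp
    hence "y = 0\<^sub>v k"
      using ker y by blast
    thus ?thesis
      using y G by auto
  qed
  moreover have "0\<^sub>v n \<in> code_of_generator G"
    using G by (auto simp: C_eq intro!: bexI[of _ "0\<^sub>v k"])
  moreover have "0\<^sub>v n \<in> dual_code n (code_of_generator G)"
    using C_eq by (auto simp: dual_code_def)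
  ultimately show ?thesis
    unfolding lcd_def by blast
qed

lemma append_cols_carrier_mat:
  assumes "A \<in> carrier_mat k n1" "B \<in> carrier_mat k n2"
  shows "append_cols A B \<in> carrier_mat k (n1 + n2)"
  using four_block_carrier_mat[OF assms(1), of "0\<^sub>m 0 n2" 0 n2 B] assms
  by (auto simp: append_cols_def)

lemma append_cols_mult_transpose:
  fixes A B :: "'b::comm_ring_1 mat"
  assumes A: "A \<in> carrier_mat k n1" and B: "B \<in> carrier_mat k n2"
  shows "append_cols A B * (append_cols A B)\<^sup>T = A * A\<^sup>T + B * B\<^sup>T"
proof -
  have "(append_cols A B)\<^sup>T = four_block_mat A\<^sup>T (0\<^sub>m n1 0) B\<^sup>T (0\<^sub>m n2 0)"
    using A B transpose_four_block_mat[OF A B, of "0\<^sub>m 0 n1" 0 "0\<^sub>m 0 n2"]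
    by (simp add: append_cols_def)
  moreover have "append_cols A B = four_block_mat A B (0\<^sub>m 0 n1) (0\<^sub>m 0 n2)"
    using A B by (simp add: append_cols_def)
  ultimately have "append_cols A B * (append_cols A B)\<^sup>T =
      four_block_mat (A * A\<^sup>T + B * B\<^sup>T) (A * 0\<^sub>m n1 0 + B * 0\<^sub>m n2 0)
        (0\<^sub>m 0 n1 * A\<^sup>T + 0\<^sub>m 0 n2 * B\<^sup>T) (0\<^sub>m 0 n1 * 0\<^sub>m n1 0 + 0\<^sub>m 0 n2 * 0\<^sub>m n2 0)"
    using mult_four_block_mat[OF A B, of "0\<^sub>m 0 n1" 0 "0\<^sub>m 0 n2" "A\<^sup>T" k "0\<^sub>m n1 0" 0 "B\<^sup>T" "0\<^sub>m n2 0"]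
      A B by simp
  \<comment> \<open>The other three blocks have no rows or no columns.\<close>
  also have "\<dots> = A * A\<^sup>T + B * B\<^sup>T"
    using A B by (intro eq_matI) auto
  finally show ?thesis .
qed

section \<open>Convolution on a finite abelian group\<close>

definition conv :: "('a::{ab_group_add,finite} \<Rightarrow> 'b::comm_ring_1) \<Rightarrow> ('a \<Rightarrow> 'b) \<Rightarrow> 'a \<Rightarrow> 'b" where
  "conv f g y = (\<Sum>z\<in>UNIV. f z * g (y - z))"

lemma conv_commute: "conv f g = conv g f"
proof
  fix y
  show "conv f g y = conv g f y"
    unfolding conv_def
    by (rule sum.reindex_bij_witness[of _ "\<lambda>z. y - z" "\<lambda>z. y - z"]) (auto simp: mult.commute)
qed

lemma conv_assoc: "conv (conv f g) h = conv f (conv g h)"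
proof
  fix y
  have "conv (conv f g) h y = (\<Sum>z\<in>UNIV. \<Sum>w\<in>UNIV. f w * g (z - w) * h (y - z))"
    by (simp add: conv_def sum_distrib_right)
  also have "\<dots> = (\<Sum>w\<in>UNIV. \<Sum>z\<in>UNIV. f w * g (z - w) * h (y - z))"
    by (rule sum.swap)
  also have "\<dots> = (\<Sum>w\<in>UNIV. \<Sum>z\<in>UNIV. f w * g z * h (y - w - z))"
  proof (rule sum.cong)
    fix w
    show "(\<Sum>z\<in>UNIV. f w * g (z - w) * h (y - z)) = (\<Sum>z\<in>UNIV. f w * g z * h (y - w - z))"
      by (rule sum.reindex_bij_witness[of _ "\<lambda>z. z + w" "\<lambda>z. z - w"]) (auto simp: algebra_simps)
  qed simp
  also have "\<dots> = conv f (conv g h) y"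
    by (simp add: conv_def sum_distrib_left mult.assoc)
  finally show "conv (conv f g) h y = conv f (conv g h) y" .
qed

lemma conv_add_right: "conv f (\<lambda>y. g y + h y) y = conv f g y + conv f h y"
  by (simp add: conv_def distrib_left sum.distrib)

lemma conv_smult_right: "conv f (\<lambda>y. c * g y) y = c * conv f g y"
  by (simp add: conv_def sum_distrib_left mult_ac)

lemma conv_funpow: "(conv f ^^ k) (conv g h) = conv ((conv f ^^ k) g) h"
  by (induction k) (simp_all add: conv_assoc)

section \<open>Characters of order \<open>N\<close> and Jacobi sums\<close>

text \<open>By \<open>pow_N\<close> and \<open>pow_nontrivial\<close> the order is exactly
  \<open>N\<close>. The extension by 0 lets convolutions run over the whole field.\<close>

locale multiplicative_character =
  fixes \<chi> :: "'a::{field,finite} \<Rightarrow> 'b::field" and N :: nat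
  assumes zero: "\<chi> 0 = 0" and one: "\<chi> 1 = 1" and mult: "\<chi> (x * y) = \<chi> x * \<chi> y"
    and N_gt_1: "N > 1" and pow_N: "x \<noteq> 0 \<Longrightarrow> \<chi> x ^ N = 1"
    and pow_nontrivial: "0 < j \<Longrightarrow> j < N \<Longrightarrow> \<exists>x. x \<noteq> 0 \<and> \<chi> x ^ j \<noteq> 1"
begin

lemma minus: "\<chi> (- x) = \<chi> (- 1) * \<chi> x"
  using mult[of "- 1" x] by simp

lemma minus_one_cases: "\<chi> (- 1) = 1 \<or> \<chi> (- 1) = - 1"
  using mult[of "- 1" "- 1"] one by (metis minus_mult_minus mult_1 square_eq_1_iff)

text \<open>Replacing \<open>x\<close> by \<open>a * x\<close> multiplies the sum by
  \<open>\<chi> a ^ j\<close>, which differs from 1 for a suitable \<open>a\<close>.\<close>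

lemma sum_pow:
  assumes "0 < j" "j < N"
  shows "(\<Sum>x\<in>UNIV. \<chi> x ^ j) = 0"
proof -
  obtain a where a: "a \<noteq> 0" "\<chi> a ^ j \<noteq> 1"
    using pow_nontrivial assms by blast
  have "(\<Sum>x\<in>UNIV. \<chi> x ^ j) = (\<Sum>x\<in>UNIV. \<chi> (a * x) ^ j)"
    by (rule sum.reindex_bij_witness[of _ "\<lambda>x. a * x" "\<lambda>x. x / a"]) (use a in auto)
  also have "\<dots> = \<chi> a ^ j * (\<Sum>x\<in>UNIV. \<chi> x ^ j)"
    by (simp add: mult power_mult_distrib sum_distrib_left)
  finally show ?thesis
    using a by simp
qed

text \<open>Substitute \<open>z = y * t\<close>. The remaining constant, the convolution at 1, is
  the Jacobi sum of \<open>\<chi>\<close> and \<open>\<chi> ^ k\<close>.\<close>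

lemma conv_pow_nonzero:
  assumes "y \<noteq> 0"
  shows "conv \<chi> (\<lambda>z. \<chi> z ^ k) y = conv \<chi> (\<lambda>z. \<chi> z ^ k) 1 * \<chi> y ^ Suc k"
proof -
  have "conv \<chi> (\<lambda>z. \<chi> z ^ k) y = (\<Sum>t\<in>UNIV. \<chi> (y * t) * \<chi> (y * (1 - t)) ^ k)"
    unfolding conv_def
    by (rule sum.reindex_bij_witness[of _ "\<lambda>x. y * x" "\<lambda>x. x / y"])
      (use assms in \<open>auto simp: algebra_simps\<close>)
  also have "\<dots> = conv \<chi> (\<lambda>z. \<chi> z ^ k) 1 * \<chi> y ^ Suc k"
    by (simp add: conv_def mult power_mult_distrib sum_distrib_left sum_distrib_right mult_ac)
  finally show ?thesis .
qed

lemma conv_pow_zero: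
  assumes "Suc k < N"
  shows "conv \<chi> (\<lambda>z. \<chi> z ^ k) 0 = 0"
proof -
  have 1: "\<chi> (0 - z) = \<chi> (- 1) * \<chi> z" for z
    using minus[of z] by simp
  have "conv \<chi> (\<lambda>z. \<chi> z ^ k) 0 = \<chi> (- 1) ^ k * (\<Sum>z\<in>UNIV. \<chi> z ^ Suc k)"
    by (simp only: conv_def 1) (simp add: power_mult_distrib sum_distrib_left mult_ac)
  thus ?thesis
    using sum_pow[of "Suc k"] assms by simp
qed

text \<open>Each convolution raises the exponent by one at the cost of a Jacobi sum. The bound keeps
  the exponent below \<open>N\<close>; at exponent \<open>N\<close> the value at 0 need not
  vanish.\<close>

lemma funpow_conv_self:
  assumes "k < N - 1"
  shows "\<exists>c. (conv \<chi> ^^ k) \<chi> = (\<lambda>y. c * \<chi> y ^ Suc k)"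
  using assms
proof (induction k)
  case 0
  show ?case by (auto intro: exI[of _ 1])
next
  case (Suc k)
  then obtain c where c: "(conv \<chi> ^^ k) \<chi> = (\<lambda>y. c * \<chi> y ^ Suc k)"
    by auto
  have "(conv \<chi> ^^ Suc k) \<chi> y = c * conv \<chi> (\<lambda>z. \<chi> z ^ Suc k) 1 * \<chi> y ^ Suc (Suc k)" for y
  proof (cases "y = 0")
    case True
    have "Suc (Suc k) < N"
      using Suc.prems by simp
    from conv_pow_zero[OF this] show ?thesis
      by (simp only: funpow.simps o_apply c conv_smult_right True) (simp add: zero)
  next
    case False
    show ?thesis
      by (simp only: funpow.simps o_apply c conv_smult_right conv_pow_nonzero[OF False] mult.assoc)
  qed
  thus ?case by blast
qed

text \<open>
  The constant \<open>b\<close> is the \<open>N\<close>-th power of the Gauss sum of \<open>\<chi>\<close>. No additive characters are needed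
  to find it: the \<open>N\<close>-fold convolution of \<open>\<chi>\<close> with itself is constant away from 0, and convolving
  a constant with \<open>\<chi>\<close> gives 0.
\<close>
lemma funpow_conv_eq:
  "\<exists>b. \<forall>f. (conv \<chi> ^^ Suc N) f = (\<lambda>y. b * conv \<chi> f y)"
proof -
  obtain n where N: "N = Suc (Suc n)"
    using N_gt_1 by (metis Suc_lessD less_imp_Suc_add add_Suc One_nat_def plus_1_eq_Suc)
  obtain c where c: "(conv \<chi> ^^ n) \<chi> = (\<lambda>y. c * \<chi> y ^ Suc n)"
    using funpow_conv_self[of n] N by auto
  \<comment> \<open>Here \<open>Suc n = N - 1\<close>, so \<open>g\<close> is the first convolution
    beyond \<open>funpow_conv_self\<close>. It is a constant plus a multiple of the indicator of 0,
    and that indicator is the identity for convolution.\<close>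
  define g where "g = conv \<chi> (\<lambda>z. \<chi> z ^ Suc n)"
  define b where "b = c * (g 0 - g 1)"
  have g1: "g y = g 1" if "y \<noteq> 0" for y
    using conv_pow_nonzero[OF that, of "Suc n"] pow_N[OF that] by (simp add: g_def N)
  have g: "g y = g 1 + (g 0 - g 1) * (if y = 0 then 1 else 0)" for y
    by (cases "y = 0") (simp_all add: g1[of y])
  have "conv \<chi> g y = (g 0 - g 1) * \<chi> y" for y
  proof -
    have "conv \<chi> g y = conv \<chi> (\<lambda>y. g 1 + (g 0 - g 1) * (if y = 0 then 1 else 0)) y"
      by (rule arg_cong[where f = "\<lambda>h. conv \<chi> h y"], rule ext, rule g)
    also have "\<dots> = conv \<chi> (\<lambda>_. g 1) y + (g 0 - g 1) * conv \<chi> (\<lambda>y. if y = 0 then 1 else 0) y"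
      by (simp only: conv_add_right conv_smult_right)
    also have "conv \<chi> (\<lambda>_. g 1) y = 0"
      using sum_pow[of 1] N_gt_1 by (simp add: conv_def flip: sum_distrib_right)
    also have "conv \<chi> (\<lambda>y. if y = 0 then 1 else 0) y = (\<Sum>z\<in>UNIV. if z = y then \<chi> z else 0)"
      unfolding conv_def by (rule sum.cong) auto
    also have "0 + (g 0 - g 1) * \<dots> = (g 0 - g 1) * \<chi> y"
      by simp
    finally show ?thesis .
  qed
  moreover have "(conv \<chi> ^^ N) \<chi> = conv \<chi> (\<lambda>y. c * g y)"
    unfolding N by (simp add: c conv_smult_right[abs_def] g_def del: power_Suc)
  ultimately have b: "(conv \<chi> ^^ N) \<chi> = (\<lambda>y. b * \<chi> y)"
    by (simp add: conv_smult_right[abs_def] b_def mult_ac)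
  have "(conv \<chi> ^^ Suc N) f y = b * conv \<chi> f y" for f y
  proof -
    have "(conv \<chi> ^^ Suc N) f = (conv \<chi> ^^ N) (conv \<chi> f)"
      by (simp only: funpow_Suc_right o_apply)
    also have "\<dots> = conv f (\<lambda>y. b * \<chi> y)"
      by (simp add: conv_funpow b conv_commute)
    finally show ?thesis
      by (simp only: conv_smult_right conv_commute[of f \<chi>])
  qed
  thus ?thesis by blast
qed

end

section \<open>A second-order recurrence and its polynomials\<close>

text \<open>\<open>re_pow k\<close> and \<open>im_pow k\<close> are the polynomials \<open>A\<close>, \<open>B\<close> with \<open>(i - X) ^ k = A + i B\<close>, \<open>i\<^sup>2 = -1\<close>.\<close>
fun re_pow :: "nat \<Rightarrow> 'b::field poly" and im_pow :: "nat \<Rightarrow> 'b poly" where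
  "re_pow 0 = 1"
| "im_pow 0 = 0"
| "re_pow (Suc k) = - im_pow k - [:0, 1:] * re_pow k"
| "im_pow (Suc k) = re_pow k - [:0, 1:] * im_pow k"

lemma degree_re_im_pow: "degree (re_pow k :: 'b::field poly) \<le> k \<and> degree (im_pow k :: 'b poly) \<le> k"
proof (induction k)
  case (Suc k)
  have X: "degree ([:0, 1:] * p) \<le> Suc k" if "degree p \<le> k" for p :: "'b poly"
    using that degree_mult_le[of "[:0, 1:]" p] by simp
  show ?case
    using Suc X[of "re_pow k"] X[of "im_pow k"]
    by (auto intro!: degree_diff_le simp del: mult_pCons_left)
qed auto

text \<open>The norm \<open>A^2 + B^2\<close> is multiplicative and equals \<open>1 + v^2\<close>
  for \<open>i - v\<close>.\<close>

lemma poly_re_im_pow_norm: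
  "poly (re_pow k) v ^ 2 + poly (im_pow k) v ^ 2 = (1 + v ^ 2) ^ k" for v :: "'b::field"
proof (induction k)
  case (Suc k)
  have "poly (re_pow (Suc k)) v ^ 2 + poly (im_pow (Suc k)) v ^ 2 =
      (1 + v ^ 2) * (poly (re_pow k) v ^ 2 + poly (im_pow k) v ^ 2)"
    by (simp add: power2_eq_square algebra_simps)
  thus ?case
    using Suc by simp
qed auto

text \<open>With \<open>t k = s (k + 1) + v * s k\<close>, each step multiplies the pair
  \<open>(s k, t k)\<close> by \<open>i - v\<close>, where \<open>i\<close> acts as the map from
  \<open>(s, t)\<close> to \<open>(t, - s)\<close>, whose square is -1.\<close>

lemma recurrence_re_im_pow:
  fixes s :: "nat \<Rightarrow> 'b::field"
  assumes "\<And>k. s (k + 2) = - 2 * v * s (k + 1) - (1 + v ^ 2) * s k"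
  shows "s k = poly (re_pow k) v * s 0 + poly (im_pow k) v * (s 1 + v * s 0) \<and>
    s (k + 1) + v * s k = poly (re_pow k) v * (s 1 + v * s 0) - poly (im_pow k) v * s 0"
proof (induction k)
  case (Suc k)
  define t where "t = s (Suc k) + v * s k"
  have 1: "s (Suc k) = t - v * s k"
    by (simp add: t_def)
  have 2: "s (Suc (Suc k)) + v * s (Suc k) = - s k - v * t"
  proof -
    have *: "s (Suc (Suc k)) = - 2 * v * s (k + 1) - (1 + v ^ 2) * s k"
      using assms[of k] by simp
    show ?thesis
      unfolding * t_def by (simp add: power2_eq_square algebra_simps)
  qed
  have IH: "s k = poly (re_pow k) v * s 0 + poly (im_pow k) v * (s 1 + v * s 0)"
    "t = poly (re_pow k) v * (s 1 + v * s 0) - poly (im_pow k) v * s 0"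
    unfolding t_def Suc_eq_plus1 by (rule conjunct1[OF Suc], rule conjunct2[OF Suc])
  have "s (Suc k) = poly (re_pow (Suc k)) v * s 0 + poly (im_pow (Suc k)) v * (s 1 + v * s 0)"
    unfolding 1 IH by (simp add: algebra_simps)
  moreover have "s (Suc (Suc k)) + v * s (Suc k) =
      poly (re_pow (Suc k)) v * (s 1 + v * s 0) - poly (im_pow (Suc k)) v * s 0"
    unfolding 2 IH by (simp add: algebra_simps)
  ultimately show ?case
    by simp
qed auto

section \<open>Equations for \<open>v\<close> forced by a kernel vector\<close>

text \<open>By \<open>per\<close>, the element \<open>(i - v) * ((i - v)^N - b)\<close> kills the
  nonzero pair \<open>(s 0, t)\<close>, so its norm \<open>(1 + v^2) * ((A - b)^2 + B^2)\<close>
  vanishes.\<close>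

lemma symmetric_obstruction:
  fixes s :: "nat \<Rightarrow> 'b::field"
  assumes rec: "\<And>k. s (k + 2) = - 2 * v * s (k + 1) - (1 + v ^ 2) * s k"
    and per: "\<And>k. s (N + 1 + k) = b * s (1 + k)" and "s 0 \<noteq> 0"
  shows "(1 + v ^ 2) ^ (N + 1) + b ^ 2 * (1 + v ^ 2) - 2 * b * (1 + v ^ 2) * poly (re_pow N) v = 0"
proof -
  define A B where "A = poly (re_pow N) v" and "B = poly (im_pow N) v"
  \<comment> \<open>\<open>C + i D\<close> is \<open>(i - v)^(N + 1) - b * (i - v)\<close>.\<close>
  define C D where "C = poly (re_pow (Suc N)) v + b * v" and "D = poly (im_pow (Suc N)) v - b"
  define t where "t = s 1 + v * s 0"
  note R = recurrence_re_im_pow[of s v, OF rec, folded t_def]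
  have CD: "C = - B - v * A + b * v" "D = A - v * B - b"
    by (simp_all add: C_def D_def A_def B_def)
  have "C * s 0 + D * t = s (Suc N) - b * s 1"
    using R[of "Suc N"] by (simp add: C_def D_def t_def algebra_simps del: re_pow.simps im_pow.simps)
  hence "C * s 0 + D * t = 0"
    using per[of 0] by simp
  moreover have "s (N + 2) + v * s (N + 1) = b * (s 2 + v * s 1)"
    using per[of 0] per[of 1] by (simp add: algebra_simps numeral_2_eq_2)
  moreover have "C * t - D * s 0 = (s (Suc N + 1) + v * s (Suc N)) - b * (s (1 + 1) + v * s 1)"
    unfolding conjunct2[OF R[of "Suc N"]] conjunct2[OF R[of 1]] C_def D_def
    by (simp add: algebra_simps)
  \<comment> \<open>Both bracketed terms are 0, being the coordinates of the image of
    \<open>(s 0, t)\<close> under \<open>C + i D\<close>. This combination eliminates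
    \<open>t\<close>.\<close>
  ultimately have "C * (C * s 0 + D * t) - D * (C * t - D * s 0) = 0"
    by (simp add: numeral_2_eq_2)
  hence "(C ^ 2 + D ^ 2) * s 0 = 0"
    by (simp add: power2_eq_square algebra_simps)
  hence "C ^ 2 + D ^ 2 = 0"
    using \<open>s 0 \<noteq> 0\<close> by simp
  moreover have "C ^ 2 + D ^ 2 = (1 + v ^ 2) * (A ^ 2 + B ^ 2) + b ^ 2 * (1 + v ^ 2) - 2 * b * (1 + v ^ 2) * A"
    unfolding CD by (simp add: power2_eq_square algebra_simps)
  moreover have "A ^ 2 + B ^ 2 = (1 + v ^ 2) ^ N"
    unfolding A_def B_def by (rule poly_re_im_pow_norm)
  ultimately show ?thesis
    by (simp add: A_def)
qed

text \<open>The recurrence links indices of equal parity. The index \<open>2 * (N + 1)\<close> is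
  even whatever the parity of \<open>N\<close>, and two uses of \<open>per\<close> bring it down to
  2.\<close>

lemma skew_obstruction:
  fixes s :: "nat \<Rightarrow> 'b::field"
  assumes rec: "\<And>k. s (k + 2) = (1 + v ^ 2) * s k"
    and per: "\<And>k. s (N + 1 + k) = b * s (1 + k)" and "s 0 \<noteq> 0"
  shows "(1 + v ^ 2) ^ (N + 1) - b ^ 2 * (1 + v ^ 2) = 0"
proof -
  have "s (2 * k) = (1 + v ^ 2) ^ k * s 0" for k
    using rec by (induction k) (simp_all add: mult_ac)
  hence "(1 + v ^ 2) ^ (N + 1) * s 0 = s (2 * (N + 1))"
    by metis
  also have "\<dots> = b ^ 2 * s 2"
    using per[of "N + 1"] per[of 1] by (simp add: power2_eq_square mult_2 mult.assoc add_ac numeral_2_eq_2)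
  also have "\<dots> = b ^ 2 * (1 + v ^ 2) * s 0"
    using rec[of 0] by (simp add: numeral_2_eq_2)
  finally show ?thesis
    using \<open>s 0 \<noteq> 0\<close> by simp
qed

section \<open>Choosing the diagonal value\<close>

text \<open>\<open>D\<close> cannot cancel the leading term of \<open>(1 + X^2)^k\<close>, so the
  sum is a nonzero polynomial with at most \<open>2 * k\<close> roots.\<close>

lemma exists_nonroot:
  fixes D :: "'b::{field,finite} poly"
  assumes "degree D < 2 * k" "CARD('b) > 2 * k"
  shows "\<exists>v. (1 + v ^ 2) ^ k + poly D v \<noteq> 0"
proof -
  define R where "R = [:1, 0, 1:] ^ k + D"
  have "degree ([:1, 0, 1 :: 'b:] ^ k) = 2 * k"
    by (simp add: degree_power_eq)
  hence deg: "degree R = 2 * k"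
    unfolding R_def using assms by (simp add: degree_add_eq_left)
  hence "R \<noteq> 0"
    using assms by force
  hence "card {v. poly R v = 0} \<le> 2 * k"
    using card_poly_roots_bound deg by metis
  hence "{v. poly R v = 0} \<noteq> UNIV"
    using assms by force
  thus ?thesis
    by (force simp: R_def power2_eq_square)
qed

text \<open>The equation is \<open>(I + P P^T) f = 0\<close> read on functions: \<open>P^T\<close>
  acts as \<open>v + S\<close>, and \<open>P\<close> as \<open>v + \<epsilon> S\<close>.\<close>

lemma exists_trivial_kernel:
  fixes \<chi> :: "'a::{field,finite} \<Rightarrow> 'b::{field,finite}"
  assumes "multiplicative_character \<chi> N" and q: "CARD('b) > 2 * (N + 1)"
  shows "\<exists>v. \<forall>f. (\<forall>y. f y + v * (v * f y + conv \<chi> f y) +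
    \<chi> (- 1) * conv \<chi> (\<lambda>y. v * f y + conv \<chi> f y) y = 0) \<longrightarrow> f = (\<lambda>_. 0)"
proof -
  interpret multiplicative_character \<chi> N by fact
  define S where "S = conv \<chi>"
  define \<epsilon> where "\<epsilon> = \<chi> (- 1)"
  obtain b where b: "\<And>f. (S ^^ Suc N) f = (\<lambda>y. b * S f y)"
    unfolding S_def using funpow_conv_eq by blast
  have per: "(S ^^ (N + 1 + k)) f y = b * (S ^^ (1 + k)) f y" for k f y
  proof -
    have "(S ^^ (N + 1 + k)) f = (S ^^ Suc N) ((S ^^ k) f)"
      by (simp only: Suc_eq_plus1 funpow_add o_apply)
    thus ?thesis
      using b by simp
  qed
  \<comment> \<open>This is the kernel equation after \<open>k\<close> further applications of
    \<open>S\<close>.\<close>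
  have rec: "(1 + v ^ 2) * (S ^^ k) f y + v * (1 + \<epsilon>) * (S ^^ (k + 1)) f y + \<epsilon> * (S ^^ (k + 2)) f y = 0"
    if ker: "\<And>y. f y + v * (v * f y + S f y) + \<epsilon> * S (\<lambda>y. v * f y + S f y) y = 0" for v f k y
  proof (induction k arbitrary: y)
    case 0
    have "S (\<lambda>y. v * f y + S f y) y = v * S f y + S (S f) y" for y
      by (simp only: S_def conv_add_right conv_smult_right)
    thus ?case
      using ker[of y] by (simp add: power2_eq_square algebra_simps)
  next
    case (Suc k)
    have "0 = S (\<lambda>y. (1 + v ^ 2) * (S ^^ k) f y + v * (1 + \<epsilon>) * (S ^^ (k + 1)) f y +
        \<epsilon> * (S ^^ (k + 2)) f y) y"
      unfolding Suc by (simp add: S_def conv_def)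
    also have "\<dots> = (1 + v ^ 2) * (S ^^ Suc k) f y + v * (1 + \<epsilon>) * (S ^^ (Suc k + 1)) f y +
        \<epsilon> * (S ^^ (Suc k + 2)) f y"
      by (simp only: S_def conv_add_right conv_smult_right) simp
    finally show ?case by simp
  qed
  \<comment> \<open>\<open>D\<close> collects the terms of the two obstructions other than
    \<open>(1 + v^2)^(N + 1)\<close>. It is fixed before any kernel function is given, so one
    \<open>v\<close> serves them all.\<close>
  define D where "D = (if \<epsilon> = 1
    then Polynomial.smult (b ^ 2) [:1, 0, 1:] - Polynomial.smult (2 * b) ([:1, 0, 1:] * re_pow N)
    else - Polynomial.smult (b ^ 2) [:1, 0, 1:])"
  have D1: "degree (Polynomial.smult (b ^ 2) [:1, 0, 1:]) < 2 * (N + 1)"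
    using degree_smult_le[of "b ^ 2" "[:1, 0, 1:]"] N_gt_1 by simp
  have "degree ([:1, 0, 1:] * re_pow N :: 'b poly) \<le> 2 + N"
    using degree_mult_le[of "[:1, 0, 1::'b:]" "re_pow N"] degree_re_im_pow[of N, where 'b='b] by simp
  hence "degree (Polynomial.smult (2 * b) ([:1, 0, 1:] * re_pow N)) \<le> 2 + N"
    by (rule order_trans[OF degree_smult_le])
  hence D2: "degree (Polynomial.smult (2 * b) ([:1, 0, 1:] * re_pow N)) < 2 * (N + 1)"
    by (rule le_less_trans) (use N_gt_1 in simp)
  have "degree D < 2 * (N + 1)"
    unfolding D_def using D1 D2 by (auto intro!: degree_diff_less simp del: mult_pCons_left)
  then obtain v where v: "(1 + v ^ 2) ^ (N + 1) + poly D v \<noteq> 0"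
    using exists_nonroot q by blast
  have "f y = 0"
    if ker: "\<And>y. f y + v * (v * f y + S f y) + \<epsilon> * S (\<lambda>y. v * f y + S f y) y = 0" for f y
  proof (rule ccontr)
    assume nz: "f y \<noteq> 0"
    define s where "s k = (S ^^ k) f y" for k
    have s0: "s 0 \<noteq> 0"
      using nz by (simp add: s_def)
    have s_per: "s (N + 1 + k) = b * s (1 + k)" for k
      unfolding s_def by (rule per)
    have s_rec: "(1 + v ^ 2) * s k + v * (1 + \<epsilon>) * s (k + 1) + \<epsilon> * s (k + 2) = 0" for k
      unfolding s_def by (rule rec[OF ker])
    show False
    \<comment> \<open>For \<open>\<epsilon> = -1\<close> the middle term of \<open>s_rec\<close>
      cancels. In characteristic 2 the two signs coincide and the first case covers both.\<close>
    proof (cases "\<epsilon> = 1")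
      case True
      have "s (k + 2) = - 2 * v * s (k + 1) - (1 + v ^ 2) * s k" for k
      proof -
        have "s (k + 2) = - (v * (1 + 1) * s (k + 1)) - (1 + v ^ 2) * s k"
          using s_rec[of k] True by (simp add: algebra_simps eq_neg_iff_add_eq_0)
        thus ?thesis by (simp add: algebra_simps)
      qed
      from symmetric_obstruction[of s v N b, OF this s_per s0] show False
        using v True by (simp add: D_def power2_eq_square algebra_simps)
    next
      case False
      hence "\<epsilon> = - 1"
        using minus_one_cases by (simp add: \<epsilon>_def)
      hence "s (k + 2) = (1 + v ^ 2) * s k" for k
        using s_rec[of k] by simp
      from skew_obstruction[of s v N b, OF this s_per s0] show False
        using v False by (simp add: D_def power2_eq_square algebra_simps)
    qed
  qed
  thus ?thesis
    unfolding S_def \<epsilon>_def by (intro exI[of _ v] allI impI ext) blast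
qed

section \<open>The map \<open>phi\<close> as a character\<close>

lemma primitive_element_power_card:
  fixes \<alpha> :: "'a::finite_field"
  assumes "primitive_element \<alpha>"
  shows "\<alpha> ^ (CARD('a) - 1) = 1"
proof -
  have "\<alpha> \<noteq> 0"
    using assms by (simp add: primitive_element_def)
  moreover have "\<alpha> * \<alpha> ^ (CARD('a) - 1) = \<alpha>"
    using finite_field_power_card_eq_same[of \<alpha>] by (simp add: power_eq_if split: if_splits)
  ultimately show ?thesis
    by simp
qed

lemma CARD_field_ge_2: "CARD('a::{field,finite}) \<ge> 2"
  using card_mono[of UNIV "{0, 1::'a}"] by simp

lemma primitive_element_power_neq_1:
  fixes \<alpha> :: "'a::finite_field"
  assumes "primitive_element \<alpha>" "0 < k" "k < CARD('a) - 1"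
  shows "\<alpha> ^ k \<noteq> 1"
proof -
  have "k \<in> {..CARD('a) - 2}"
    using assms(3) unfolding atMost_iff by linarith
  thus ?thesis
    using inj_onD[OF primitive_element_inj_on[OF assms(1)], of k 0] assms(2) by auto
qed

text \<open>Both sides depend only on \<open>k\<close> modulo \<open>CARD('a) - 1\<close>: on the
  right because \<open>u ^ N = 1\<close> and \<open>N\<close> divides this modulus. Multiplicativity
  then needs no care about wrap-around of exponents.\<close>

lemma phi_power_any:
  fixes \<alpha> :: "'a::finite_field" and \<beta> :: "'b::finite_field"
  assumes "primitive_element \<alpha>" "primitive_element \<beta>" "N dvd CARD('a) - 1" "N dvd CARD('b) - 1"
  shows "phi \<alpha> \<beta> N (\<alpha> ^ k) = (\<beta> ^ ((CARD('b) - 1) div N)) ^ k"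
proof -
  define n where "n = CARD('a) - 1"
  define u where "u = \<beta> ^ ((CARD('b) - 1) div N)"
  have n: "n > 0"
    using CARD_field_ge_2[where 'a='a] by (simp add: n_def)
  have "u ^ N = 1"
    using assms primitive_element_power_card[of \<beta>] by (simp add: u_def flip: power_mult)
  moreover obtain d where "n = N * d"
    using assms(3) unfolding n_def by (elim dvdE)
  ultimately have u: "u ^ n = 1"
    by (simp add: power_mult)
  have red: "w ^ k = w ^ (k mod n)" if "w ^ n = 1" for w :: "'c::monoid_mult"
    by (metis that mult_div_mod_eq power_add power_mult power_one mult_1)
  have "k mod n \<le> CARD('a) - 2"
    using mod_less_divisor[OF n, of k] by (simp add: n_def)
  hence "phi \<alpha> \<beta> N (\<alpha> ^ (k mod n)) = u ^ (k mod n)"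
    unfolding u_def by (intro phi_power assms)
  thus ?thesis
    using red[of \<alpha>] red[OF u] primitive_element_power_card[OF assms(1)] by (simp add: n_def u_def)
qed

text \<open>The order is exactly \<open>N\<close> because \<open>u ^ j\<close> is a power of the
  primitive \<open>\<beta>\<close> with exponent strictly between 0 and \<open>CARD('b) - 1\<close>;
  \<open>\<alpha>\<close> itself witnesses nontriviality.\<close>

lemma multiplicative_character_phi:
  fixes \<alpha> :: "'a::finite_field" and \<beta> :: "'b::finite_field"
  assumes "primitive_element \<alpha>" "primitive_element \<beta>" "N > 1" "N dvd CARD('a) - 1" "N dvd CARD('b) - 1"
  shows "multiplicative_character (\<lambda>y. if y = 0 then 0 else phi \<alpha> \<beta> N y) N"
proof -
  define u where "u = \<beta> ^ ((CARD('b) - 1) div N)"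
  have phi: "phi \<alpha> \<beta> N (\<alpha> ^ k) = u ^ k" for k
    unfolding u_def using assms by (intro phi_power_any)
  have \<alpha>: "\<alpha> \<noteq> 0" "\<And>y. y \<noteq> 0 \<Longrightarrow> \<exists>k. y = \<alpha> ^ k"
    using assms by (auto simp: primitive_element_def)
  have u_N: "u ^ N = 1"
    using assms primitive_element_power_card[of \<beta>] by (simp add: u_def flip: power_mult)
  have u_j: "u ^ j \<noteq> 1" if "0 < j" "j < N" for j
  proof -
    define d where "d = (CARD('b) - 1) div N"
    have d: "CARD('b) - 1 = d * N"
      using assms by (simp add: d_def)
    hence "d > 0"
      using CARD_field_ge_2[where 'a='b] by (cases d) auto
    hence "\<beta> ^ (d * j) \<noteq> 1"
      using that d by (intro primitive_element_power_neq_1 assms) auto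
    thus ?thesis
      by (simp add: u_def d_def power_mult)
  qed
  show ?thesis
  proof
    show "(if x * y = 0 then 0 else phi \<alpha> \<beta> N (x * y)) =
        (if x = 0 then 0 else phi \<alpha> \<beta> N x) * (if y = 0 then 0 else phi \<alpha> \<beta> N y)" for x y
    proof (cases "x = 0 \<or> y = 0")
      case False
      then obtain j k where jk: "x = \<alpha> ^ j" "y = \<alpha> ^ k"
        using \<alpha>(2)[of x] \<alpha>(2)[of y] by blast
      have "phi \<alpha> \<beta> N (x * y) = u ^ (j + k)"
        unfolding jk power_add[symmetric] by (rule phi)
      thus ?thesis
        using False \<alpha> by (simp add: jk phi power_add)
    qed auto
    show "(if x = 0 then 0 else phi \<alpha> \<beta> N x) ^ N = 1" if nz: "x \<noteq> 0" for x
    proof -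
      obtain k where x: "x = \<alpha> ^ k"
        using \<alpha>(2)[OF nz] by blast
      have "(u ^ k) ^ N = (u ^ N) ^ k"
        by (metis power_mult mult.commute)
      thus ?thesis
        using \<alpha>(1) by (simp add: x phi u_N)
    qed
    show "\<exists>x. x \<noteq> 0 \<and> (if x = 0 then 0 else phi \<alpha> \<beta> N x) ^ j \<noteq> 1" if "0 < j" "j < N" for j
    proof (intro exI conjI)
      show "(if \<alpha> = 0 then 0 else phi \<alpha> \<beta> N \<alpha>) ^ j \<noteq> 1"
        using u_j[OF that] phi[of 1] \<alpha>(1) by simp
    qed (fact \<alpha>(1))
  qed (use phi[of 0] assms in auto)
qed

section \<open>The matrix as a convolution operator\<close>

text \<open>Row \<open>i\<close> of the transpose has entries \<open>\<chi> (x i - x j)\<close>, a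
  convolution kernel. In \<open>P\<close> the difference is reversed, which costs the factor
  \<open>\<chi> (- 1)\<close>.\<close>

lemma mat_mult_vec_eq_conv:
  fixes \<chi> :: "'a::{field,finite} \<Rightarrow> 'b::field" and x :: "nat \<Rightarrow> 'a"
  assumes x: "bij_betw x {..<n} UNIV" and \<chi>: "multiplicative_character \<chi> N"
    and P: "P = mat n n (\<lambda>(i, j). if i = j then v else \<chi> (x j - x i))"
  shows "P *\<^sub>v vec n (\<lambda>i. f (x i)) = vec n (\<lambda>i. v * f (x i) + \<chi> (- 1) * conv \<chi> f (x i))"
    and "P\<^sup>T *\<^sub>v vec n (\<lambda>i. f (x i)) = vec n (\<lambda>i. v * f (x i) + conv \<chi> f (x i))"
proof -
  interpret multiplicative_character \<chi> N by fact
  have conv: "(\<Sum>j<n. \<chi> (x i - x j) * f (x j)) = conv \<chi> f (x i)" for i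
  proof -
    have "(\<Sum>j<n. \<chi> (x i - x j) * f (x j)) = (\<Sum>z\<in>UNIV. \<chi> (x i - z) * f z)"
      by (rule sum.reindex_bij_betw[OF x])
    also have "\<dots> = conv f \<chi> (x i)"
      by (simp add: conv_def mult.commute)
    finally show ?thesis
      by (simp add: conv_commute)
  qed
  \<comment> \<open>Since \<open>\<chi> 0 = 0\<close>, the diagonal entry \<open>v\<close> can be
    split off while the other sum still runs over all \<open>j\<close>.\<close>
  have diag: "(\<Sum>j<n. (if i = j then v else g j) * f (x j)) = v * f (x i) + (\<Sum>j<n. g j * f (x j))"
    if "i < n" "g i = 0" for i g
  proof -
    have "(\<Sum>j<n. (if i = j then v else g j) * f (x j)) =
        (\<Sum>j<n. (if i = j then v * f (x i) else 0) + g j * f (x j))"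
      using that by (intro sum.cong) auto
    thus ?thesis
      using that by (simp add: sum.distrib)
  qed
  show "P *\<^sub>v vec n (\<lambda>i. f (x i)) = vec n (\<lambda>i. v * f (x i) + \<chi> (- 1) * conv \<chi> f (x i))"
  proof (rule eq_vecI)
    fix i assume "i < dim_vec (vec n (\<lambda>i. v * f (x i) + \<chi> (- 1) * conv \<chi> f (x i)))"
    hence i: "i < n" by simp
    have "(P *\<^sub>v vec n (\<lambda>i. f (x i))) $ i = (\<Sum>j<n. (if i = j then v else \<chi> (x j - x i)) * f (x j))"
      using i by (simp add: P scalar_prod_def atLeast0LessThan)
    also have "\<dots> = v * f (x i) + (\<Sum>j<n. \<chi> (x j - x i) * f (x j))"
      using i by (intro diag) (auto simp: zero)
    also have "(\<Sum>j<n. \<chi> (x j - x i) * f (x j)) = \<chi> (- 1) * (\<Sum>j<n. \<chi> (x i - x j) * f (x j))"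
      using minus[of "x i - x j" for j] by (simp add: sum_distrib_left mult.assoc)
    finally show "(P *\<^sub>v vec n (\<lambda>i. f (x i))) $ i =
        vec n (\<lambda>i. v * f (x i) + \<chi> (- 1) * conv \<chi> f (x i)) $ i"
      using i by (simp add: conv)
  qed (simp add: P)
  show "P\<^sup>T *\<^sub>v vec n (\<lambda>i. f (x i)) = vec n (\<lambda>i. v * f (x i) + conv \<chi> f (x i))"
  proof (rule eq_vecI)
    fix i assume "i < dim_vec (vec n (\<lambda>i. v * f (x i) + conv \<chi> f (x i)))"
    hence i: "i < n" by simp
    have "(P\<^sup>T *\<^sub>v vec n (\<lambda>i. f (x i))) $ i = (\<Sum>j<n. (if j = i then v else \<chi> (x i - x j)) * f (x j))"
      using i by (simp add: P scalar_prod_def atLeast0LessThan)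
    also have "\<dots> = (\<Sum>j<n. (if i = j then v else \<chi> (x i - x j)) * f (x j))"
      by (intro sum.cong) auto
    also have "\<dots> = v * f (x i) + (\<Sum>j<n. \<chi> (x i - x j) * f (x j))"
      using i by (intro diag) (auto simp: zero)
    finally show "(P\<^sup>T *\<^sub>v vec n (\<lambda>i. f (x i))) $ i = vec n (\<lambda>i. v * f (x i) + conv \<chi> f (x i)) $ i"
      using i by (simp add: conv)
  qed (simp add: P)
qed

theorem theorem4p6:
  fixes r m N p e q :: nat
    and \<alpha> :: "'a::finite_field" and \<beta> :: "'b::finite_field"
    and x :: "nat \<Rightarrow> 'a"
  assumes "prime r" and "m > 0" and "N > 1" and "N dvd r ^ m - 1"
    and "prime p" and "e > 0" and "q = p ^ e" and "coprime p r" and "N dvd q - 1"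
    and "CARD('a) = r ^ m" and "CARD('b) = q"
    and "primitive_element \<alpha>" and "primitive_element \<beta>"
    and "bij_betw x {..<r ^ m} UNIV"
    and "q > 2 * (N + 1)"
  shows "\<exists>v::'b. linear_code (2 * r ^ m) (r ^ m) (phi_code \<alpha> \<beta> N x v) \<and>
                 lcd (2 * r ^ m) (phi_code \<alpha> \<beta> N x v)"
proof -
  define n where "n = r ^ m"
  define \<chi> where "\<chi> = (\<lambda>y. if y = 0 then 0 else phi \<alpha> \<beta> N y)"
  have card: "CARD('a) = n" and x: "bij_betw x {..<n} UNIV"
    using assms by (auto simp: n_def)
  have \<chi>: "multiplicative_character \<chi> N"
    unfolding \<chi>_def using assms by (intro multiplicative_character_phi) auto
  obtain v where v: "\<And>f. (\<And>y. f y + v * (v * f y + conv \<chi> f y) +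
      \<chi> (- 1) * conv \<chi> (\<lambda>y. v * f y + conv \<chi> f y) y = 0) \<Longrightarrow> f = (\<lambda>_. 0)"
    using exists_trivial_kernel[OF \<chi>] assms by auto
  define P where "P = phi_matrix \<alpha> \<beta> N x v"
  define G where "G = append_cols (1\<^sub>m n) P"
  have x_eq_iff: "x i = x j \<longleftrightarrow> i = j" if "i < n" "j < n" for i j
    using x that by (auto simp: bij_betw_def inj_on_def)
  \<comment> \<open>Off the diagonal \<open>x j - x i\<close> is nonzero, so \<open>phi\<close> and
    its extension by 0 agree there.\<close>
  have P_eq: "P = mat n n (\<lambda>(i, j). if i = j then v else \<chi> (x j - x i))"
    unfolding P_def phi_matrix_def card by (intro eq_matI) (auto simp: \<chi>_def x_eq_iff)
  have P: "P \<in> carrier_mat n n"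
    by (simp add: P_eq)
  have G: "G \<in> carrier_mat n (2 * n)"
    using append_cols_carrier_mat[OF one_carrier_mat P] by (simp add: G_def mult_2)
  have ker: "y = 0\<^sub>v n" if y: "y \<in> carrier_vec n" and "(G * G\<^sup>T) *\<^sub>v y = 0\<^sub>v n" for y
  proof -
    \<comment> \<open>The vector \<open>y\<close> is transported along the enumeration to a function
      on the field.\<close>
    define f where "f z = y $ the_inv_into {..<n} x z" for z
    have f: "f (x i) = y $ i" if "i < n" for i
      using that x by (simp add: f_def bij_betw_def the_inv_into_f_f)
    hence y_eq: "y = vec n (\<lambda>i. f (x i))"
      using y by (intro eq_vecI) auto
    note conv = mat_mult_vec_eq_conv[OF x \<chi> P_eq]
    have "0\<^sub>v n = (1\<^sub>m n + P * P\<^sup>T) *\<^sub>v y"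
      using that append_cols_mult_transpose[OF one_carrier_mat P] by (simp add: G_def)
    also have "\<dots> = y + P *\<^sub>v (P\<^sup>T *\<^sub>v y)"
      using P y by (simp add: add_mult_distrib_mat_vec[of _ n n])
    also have "\<dots> = vec n (\<lambda>i. f (x i) + (v * (v * f (x i) + conv \<chi> f (x i)) +
        \<chi> (- 1) * conv \<chi> (\<lambda>z. v * f z + conv \<chi> f z) (x i)))"
      unfolding y_eq conv by (subst conv(1)) auto
    finally have E: "vec n (\<lambda>i. f (x i) + (v * (v * f (x i) + conv \<chi> f (x i)) +
        \<chi> (- 1) * conv \<chi> (\<lambda>z. v * f z + conv \<chi> f z) (x i))) = 0\<^sub>v n" ..
    have "f z + v * (v * f z + conv \<chi> f z) + \<chi> (- 1) * conv \<chi> (\<lambda>z. v * f z + conv \<chi> f z) z = 0" for z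
    proof -
      have "z \<in> x ` {..<n}"
        using x by (simp add: bij_betw_def)
      then obtain i where "i < n" "z = x i"
        by blast
      thus ?thesis
        using arg_cong[OF E, of "\<lambda>w. w $ i"] by (simp add: add.assoc)
    qed
    hence "f = (\<lambda>_. 0)"
      by (rule v)
    thus ?thesis
      unfolding y_eq by auto
  qed
  \<comment> \<open>The kernel of \<open>G\<^sup>T\<close> lies in that of
    \<open>G * G\<^sup>T\<close>, so \<open>ker\<close> yields the dimension as well as the LCD
    property.\<close>
  have "y = 0\<^sub>v n" if "y \<in> carrier_vec n" "G\<^sup>T *\<^sub>v y = 0\<^sub>v (2 * n)" for y
  proof (rule ker)
    have "(G * G\<^sup>T) *\<^sub>v y = G *\<^sub>v (G\<^sup>T *\<^sub>v y)"
      using G that(1) by (intro assoc_mult_mat_vec) auto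
    moreover have "G *\<^sub>v 0\<^sub>v (2 * n) = 0\<^sub>v n"
      using G by (intro eq_vecI) auto
    ultimately show "(G * G\<^sup>T) *\<^sub>v y = 0\<^sub>v n"
      using that(2) by simp
  qed (fact that(1))
  hence "linear_code (2 * n) n (code_of_generator G)"
    using G by (intro linear_code_code_of_generator)
  moreover have "lcd (2 * n) (code_of_generator G)"
    using G ker by (rule lcd_code_of_generator)
  moreover have "phi_code \<alpha> \<beta> N x v = code_of_generator G"
    by (simp add: phi_code_def G_def P_def card)
  ultimately show ?thesis
    unfolding n_def by (intro exI[of _ v]) simp
qed

end
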